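(* Let $X$ be a Banach space and let $\{\mathcal{A}(t)\}_{t\in\mathbb{R}}$ be a pullback attractor of an evolution process $\{S(t,s)\}$ on $X$, with $R_{\mathcal{A}}:=\sup_{t\in\mathbb{R}}\sup_{u\in\mathcal{A}(t)}\|u\|_X<\infty$. Assume that there are projections $P(t):X\to P(t)X$, $t\in\mathbb{R}$, of finite rank $\Lambda=\dim P(t)X\ge 1$ (independent of $t$), positive numbers $M_1,M_2,M_3$, constants $\lambda_0,\lambda_1\in\mathbb{R}$ and some $s_0\ge 0$ such that for every $t\in\mathbb{R}$ and all $\varphi,\psi\in\mathcal{A}(t-s_0)$ $$\|P(t)S(t,t-s_0)\varphi-P(t)S(t,t-s_0)\psi\|\le M_1e^{\lambda_0s_0}\|\varphi-\psi\|,$$ $$\|(I-P(t))S(t,t-s_0)\varphi-(I-P(t))S(t,t-s_0)\psi\|\le\left(M_2e^{\lambda_1s_0}+M_3e^{\lambda_0s_0}\right)\|\varphi-\psi\|.$$ Assume also that there exists $0<\alpha<M_1$ such that $$\zeta:=\alpha e^{\lambda_0s_0}+M_2e^{\lambda_1s_0}+M_3e^{\lambda_0s_0}<1.$$ Then for every $t\in\mathbb{R}$ the fractal dimension of $\mathcal{A}(t)$ satisfies $$\dim_f\mathcal{A}(t)\le\frac{\ln\Lambda+\Lambda\ln\left(2+\frac{2M_1}{\alpha}\right)}{-\ln\zeta}<\infty.$$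
   Context: An evolution process on $X$ is a family of maps $S(t,s):X\to X$, $t\ge s$, $t,s\in\mathbb{R}$, with $S(t,\tau)S(\tau,s)=S(t,s)$ for $t\ge\tau\ge s$ and $S(s,s)=\mathrm{Id}_X$. A family of compact sets $\{\mathcal{A}(t)\}_{t\in\mathbb{R}}$ is a pullback attractor for the process if (i) $S(t,\tau)\mathcal{A}(\tau)=\mathcal{A}(t)$ for all $t\ge\tau$, and (ii) $\lim_{s\to\infty}\operatorname{dist}(S(t,t-s)D,\mathcal{A}(t))=0$ for every $t\in\mathbb{R}$ and every bounded $D\subset X$, where $\operatorname{dist}(A,B)=\sup_{a\in A}\inf_{b\in B}\|a-b\|_X$. The fractal dimension (capacity) of a compact set $K\subset X$ is $\dim_fK=\limsup_{\varepsilon\to0}\frac{\ln N_\varepsilon(K)}{-\ln\varepsilon}$, where $N_\varepsilon(K)$ is the minimum number of balls of $X$ of radius less than $\varepsilon$ needed to cover $K$. "Projection" means a linear projection on $X$. *)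

theory Defs
  imports "HOL-Analysis.Analysis"
begin

definition evolution_process :: "(real \<Rightarrow> real \<Rightarrow> 'a \<Rightarrow> 'a) \<Rightarrow> bool" where
  "evolution_process S \<longleftrightarrow>
     (\<forall>t \<tau> s. s \<le> \<tau> \<and> \<tau> \<le> t \<longrightarrow> S t \<tau> \<circ> S \<tau> s = S t s) \<and> (\<forall>s. S s s = id)"

text \<open>Valued in \<open>[0, \<infinity>]\<close>, so that the infimum over an empty \<open>B\<close> is \<open>\<infinity>\<close> and the supremum
  over an unbounded \<open>A\<close> keeps its meaning.\<close>

definition hausdorff_semidist :: "'a::real_normed_vector set \<Rightarrow> 'a set \<Rightarrow> ennreal" where
  "hausdorff_semidist A B = (SUP a\<in>A. INF b\<in>B. ennreal (norm (a - b)))"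

definition pullback_attractor ::
    "(real \<Rightarrow> real \<Rightarrow> 'a \<Rightarrow> 'a::real_normed_vector) \<Rightarrow> (real \<Rightarrow> 'a set) \<Rightarrow> bool" where
  "pullback_attractor S A \<longleftrightarrow>
     (\<forall>t. compact (A t)) \<and>
     (\<forall>t \<tau>. \<tau> \<le> t \<longrightarrow> S t \<tau> ` A \<tau> = A t) \<and>
     (\<forall>t D. bounded D \<longrightarrow>
        ((\<lambda>s. hausdorff_semidist (S t (t - s) ` D) (A t)) \<longlongrightarrow> 0) at_top)"

text \<open>Centres range over the whole space. A finite cover exists for every \<open>\<epsilon> > 0\<close> when \<open>K\<close> is
  compact; for other \<open>K\<close> the value of \<open>LEAST\<close> may be meaningless.\<close>

definition covering_number :: "real \<Rightarrow> 'a::real_normed_vector set \<Rightarrow> nat" where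
  "covering_number \<epsilon> K =
     (LEAST n. \<exists>\<B>. finite \<B> \<and> card \<B> = n \<and>
        (\<forall>B\<in>\<B>. \<exists>x r. 0 < r \<and> r < \<epsilon> \<and> B = ball x r) \<and> K \<subseteq> \<Union>\<B>)"

definition fractal_dim :: "'a::real_normed_vector set \<Rightarrow> ereal" where
  "fractal_dim K =
     Limsup (at_right 0) (\<lambda>\<epsilon>. ereal (ln (real (covering_number \<epsilon> K)) / (- ln \<epsilon>)))"

text \<open>Continuity is not required. As \<open>dim\<close> is \<open>0\<close> for an infinite-dimensional subspace, the
  dimension equation alone would only force finite rank for \<open>n \<noteq> 0\<close>; finiteness is therefore
  stated separately.\<close>

definition projection_of_rank :: "('a::real_vector \<Rightarrow> 'a) \<Rightarrow> nat \<Rightarrow> bool" where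
  "projection_of_rank P n \<longleftrightarrow>
     linear P \<and> P \<circ> P = P \<and> (\<exists>B. finite B \<and> range P = span B) \<and> dim (range P) = n"

end

theory Submission
  imports Defs
begin

text \<open>
  Over a time step of length \<open>s0\<close>, the process maps \<open>\<A>(t - s0)\<close> onto \<open>\<A>(t)\<close>. A subset of
  \<open>\<A>(t - s0)\<close> of diameter \<open>d\<close> is mapped to a set whose projection under \<open>P(t)\<close> has diameter at most
  \<open>M1 * exp (lam0 * s0) * d\<close> and lies in a space of dimension \<open>\<Lambda>\<close>. Splitting this projection into
  pieces of diameter \<open>\<alpha> * exp (lam0 * s0) * d\<close> splits the image into pieces of diameter at most
  \<open>\<zeta> * d\<close>, since the complementary component adds only
  \<open>(M2 * exp (lam1 * s0) + M3 * exp (lam0 * s0)) * d\<close> (\<open>small_cover_image\<close>). If \<open>Q\<close> pieces always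
  suffice, then starting from the uniformly bounded sets \<open>\<A>(t - k * s0)\<close> and iterating \<open>k\<close> times,
  \<open>\<A>(t)\<close> is covered by \<open>Q ^ k\<close> sets of diameter \<open>\<zeta> ^ k * d\<close>, where \<open>d\<close> bounds the initial
  diameters. Hence its dimension is at most \<open>ln Q / (- ln \<zeta>)\<close>
  (\<open>fractal_dim_le_of_geometric_covers\<close>).

  The number \<open>Q = (2 + 2 * M1 / \<alpha>) ^ \<Lambda>\<close> of pieces is the delicate point. Since the hypotheses compare
  only points of the attractor, whereas a covering ball may be centred elsewhere, the iteration has
  to use sets of given diameter. Enclosing such a set in a ball about one of its points would double
  \<open>M1 / \<alpha>\<close>. This loss is avoided by an isodiametric argument (\<open>card_separated_le\<close>): among sets of
  given diameter in a finite-dimensional normed space, balls have the greatest volume, because by the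
  Brunn-Minkowski inequality the difference set \<open>X - X\<close> has at least \<open>2 ^ \<Lambda>\<close> times the volume
  of \<open>X\<close>.

  Volumes are realised by counting lattice points in large balls. The Brunn-Minkowski inequality then
  becomes a statement about finite sets of integer vectors (\<open>discrete_brunn_minkowski\<close>), proved by
  induction on the dimension from the fact that \<open>A + B + {0, 1}\<close> has at least \<open>card A + card B\<close>
  elements for finite nonempty sets of integers \<open>A\<close> and \<open>B\<close>. The scaling of volumes becomes division
  with remainder (\<open>card_lattice_ball_dilate\<close>), and the boundary terms disappear because lattice counts
  grow only polynomially (\<open>lattice_ball_slow_growth\<close>).
\<close>

section \<open>Coordinates in a finite-dimensional subspace\<close>

text \<open>Equivalence of norms in finite dimension. The space \<open>'a\<close> may be infinite-dimensional, so the
  unit sphere to be minimised over lives in the space of coordinate functions \<open>'a \<Rightarrow> real\<close> with the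
  product topology. There the cube \<open>Q\<close>, whose factors outside \<open>B\<close> are trivial, is compact by
  Tychonoff, the sphere \<open>K\<close> of the maximum norm is closed in it, and independence keeps the norm
  from vanishing on \<open>K\<close>.\<close>

lemma independent_coordinates_bounded:
  fixes B :: "'a::real_normed_vector set"
  assumes fin: "finite B" and ind: "independent B"
  obtains c where "c > 0" "\<And>u b. b \<in> B \<Longrightarrow> \<bar>u b\<bar> \<le> c * norm (\<Sum>b\<in>B. u b *\<^sub>R b)"
proof (cases "B = {}")
  case True
  then show ?thesis using that[of 1] by auto
next
  case False
  define \<phi> where "\<phi> u = (\<Sum>b\<in>B. u b *\<^sub>R b)" for u :: "'a \<Rightarrow> real"
  define Q where "Q = (PiE UNIV (\<lambda>b. if b \<in> B then {-1..1} else {0}) :: ('a \<Rightarrow> real) set)"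
  define K where "K = Q \<inter> (\<Union>b\<in>B. {u. \<bar>u b\<bar> = 1})"
  have "compactin (product_topology (\<lambda>_::'a. euclidean) UNIV) Q"
    unfolding Q_def by (subst compactin_PiE) (auto simp: compactin_euclidean_iff)
  then have "compact Q"
    by (simp add: euclidean_product_topology compactin_euclidean_iff)
  moreover have "closed (\<Union>b\<in>B. {u::'a \<Rightarrow> real. \<bar>u b\<bar> = 1})"
    by (intro closed_UN fin ballI closed_Collect_eq continuous_on_rabs continuous_on_const)
       simp
  ultimately have "compact K"
    unfolding K_def by (rule compact_Int_closed)
  moreover have "K \<noteq> {}"
  proof -
    from False obtain b where "b \<in> B" by blast
    then have "(\<lambda>x. if x = b then 1 else 0) \<in> K"
      by (auto simp: K_def Q_def)
    then show ?thesis by blast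
  qed
  moreover have "continuous_on K (\<lambda>u. norm (\<phi> u))"
    unfolding \<phi>_def
    by (intro continuous_intros continuous_on_subset[OF continuous_on_product_coordinates]) auto
  ultimately obtain u0 where u0: "u0 \<in> K" "\<And>u. u \<in> K \<Longrightarrow> norm (\<phi> u0) \<le> norm (\<phi> u)"
    using continuous_attains_inf by metis
  define m where "m = norm (\<phi> u0)"
  have "m > 0"
  proof (rule ccontr)
    assume "\<not> m > 0"
    then have "(\<Sum>b\<in>B. u0 b *\<^sub>R b) = 0" by (simp add: m_def \<phi>_def)
    then have "\<forall>b\<in>B. u0 b = 0"
      using independentD[OF ind fin subset_refl, of u0] by blast
    then show False using u0(1) by (auto simp: K_def)
  qed
  have bound: "\<bar>u b\<bar> \<le> 1 / m * norm (\<phi> u)" if b: "b \<in> B" for u b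
  proof -
    define M where "M = Max ((\<lambda>b. \<bar>u b\<bar>) ` B)"
    have le: "\<bar>u b\<bar> \<le> M" if "b \<in> B" for b
      unfolding M_def using fin that by auto
    have "M \<in> (\<lambda>b. \<bar>u b\<bar>) ` B"
      unfolding M_def using fin False by (intro Max_in) auto
    then obtain b1 where b1: "b1 \<in> B" "M = \<bar>u b1\<bar>" by auto
    show ?thesis
    proof (cases "M = 0")
      case True
      then show ?thesis using le[OF b] \<open>m > 0\<close> by simp
    next
      case False
      then have "M > 0" using b1 by auto
      define v where "v x = (if x \<in> B then u x / M else 0)" for x
      have "\<bar>v i\<bar> \<le> 1" if "i \<in> B" for i
        using le[OF that] that \<open>M > 0\<close> by (simp add: v_def)
      moreover have "\<bar>v b1\<bar> = 1" using b1 \<open>M > 0\<close> by (simp add: v_def)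
      moreover have "v i = 0" if "i \<notin> B" for i using that by (simp add: v_def)
      ultimately have "v \<in> K"
        using b1(1) by (auto simp: K_def Q_def PiE_iff abs_le_iff minus_le_iff)
      then have "m \<le> norm (\<phi> v)" unfolding m_def by (rule u0)
      also have "\<phi> v = (1 / M) *\<^sub>R \<phi> u"
        by (simp add: \<phi>_def v_def scaleR_sum_right)
      also have "norm \<dots> = norm (\<phi> u) / M" using \<open>M > 0\<close> by simp
      finally have "M \<le> 1 / m * norm (\<phi> u)"
        using \<open>m > 0\<close> \<open>M > 0\<close> by (simp add: field_simps)
      with le[OF b] show ?thesis by linarith
    qed
  qed
  show ?thesis
    by (rule that[of "1 / m"]) (use \<open>m > 0\<close> bound in \<open>auto simp: \<phi>_def\<close>)
qed

section \<open>A discrete Brunn-Minkowski inequality\<close>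

text \<open>The one-dimensional case. In \<open>\<int>\<close> the sumset of \<open>A\<close> and \<open>B\<close> may have only
  \<open>card A + card B - 1\<close> elements; thickening it by \<open>{0, 1}\<close> separates the translate of \<open>A\<close> by the
  least element of \<open>B\<close> from the translate of \<open>B\<close> by one more than the greatest element of \<open>A\<close>,
  which restores the missing point.\<close>

lemma sumset_card_int:
  fixes A B C :: "int set"
  assumes fin: "finite A" "finite B" "finite C" and ne: "A \<noteq> {}" "B \<noteq> {}"
    and sub: "\<And>a b e. a \<in> A \<Longrightarrow> b \<in> B \<Longrightarrow> e \<in> {0, 1} \<Longrightarrow> a + b + e \<in> C"
  shows "card A + card B \<le> card C"
proof -
  let ?L = "(\<lambda>a. a + Min B) ` A" and ?U = "(\<lambda>b. Max A + b + 1) ` B"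
  have "?L \<inter> ?U = {}"
  proof -
    have "a + Min B < Max A + b + 1" if "a \<in> A" "b \<in> B" for a b
      using Max_ge[OF fin(1) that(1)] Min_le[OF fin(2) that(2)] by linarith
    then show ?thesis by fastforce
  qed
  then have "card (?L \<union> ?U) = card A + card B"
    using fin by (subst card_Un_disjoint) (auto simp: card_image inj_on_def)
  moreover have "?L \<union> ?U \<subseteq> C"
    using sub[of _ "Min B" 0] sub[of "Max A" _ 1] fin ne by auto
  ultimately show ?thesis
    using card_mono[OF fin(3)] by metis
qed

text \<open>Lets a comparison of the sizes of superlevel sets be integrated into a comparison of sums. The
  cap at \<open>1\<close> comes from integrating over the levels in the unit interval only; it is harmless for
  functions normalised to maximum \<open>1\<close> and goes in the right direction for a majorant.\<close>

lemma layer_cake: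
  fixes f :: "'b \<Rightarrow> real"
  assumes "finite X" "\<And>x. x \<in> X \<Longrightarrow> 0 \<le> f x"
  shows "((\<lambda>l. real (card {x\<in>X. l \<le> f x})) has_integral (\<Sum>x\<in>X. min (f x) 1)) {0..1}"
proof -
  have "((\<lambda>l. indicator {0..min (f x) 1} l :: real) has_integral min (f x) 1) {0..1}"
    if "x \<in> X" for x
  proof -
    have "((\<lambda>l. 1::real) has_integral min (f x) 1) {0..min (f x) 1}"
      using has_integral_const_real[of "1::real" 0 "min (f x) 1"] assms(2)[OF that] by simp
    then have "((\<lambda>l. if l \<in> {0..min (f x) 1} then 1 else 0::real) has_integral min (f x) 1) {0..1}"
      by (subst has_integral_restrict) auto
    then show ?thesis by (simp add: indicator_def of_bool_def)
  qed
  then have "((\<lambda>l. \<Sum>x\<in>X. indicator {0..min (f x) 1} l :: real) has_integral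
      (\<Sum>x\<in>X. min (f x) 1)) {0..1}"
    by (intro has_integral_sum assms)
  moreover have "(\<Sum>x\<in>X. indicator {0..min (f x) 1} l) = real (card {x\<in>X. l \<le> f x})"
    if "l \<in> {0..1}" for l
  proof -
    have "(\<Sum>x\<in>X. indicator {0..min (f x) 1} l) = (\<Sum>x\<in>X. if l \<le> f x then 1 else 0 :: real)"
      using that by (intro sum.cong) (auto simp: indicator_def)
    also have "\<dots> = (\<Sum>x | x \<in> X \<and> l \<le> f x. 1)"
      using assms(1) by (subst sum.inter_filter) auto
    also have "\<dots> = real (card {x\<in>X. l \<le> f x})" by simp
    finally show ?thesis .
  qed
  ultimately show ?thesis by (rule has_integral_eq[rotated])
qed

text \<open>The functional form of the one-dimensional inequality, which is what an induction over the
  dimension needs: there \<open>f\<close>, \<open>g\<close> and \<open>h\<close> measure the slices of three sets. After scaling \<open>f\<close> and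
  \<open>g\<close> to maximum \<open>1\<close>, their superlevel sets are nonempty at every level in \<open>(0, 1]\<close>, and the
  thickened sumset of the two lies in the superlevel set of the scaled \<open>h\<close>. Summing over the levels
  bounds the sum of \<open>h\<close> below by an arithmetic mean, hence by a geometric one.\<close>

lemma prekopa_leindler_int:
  fixes f g h :: "int \<Rightarrow> real"
  assumes fin: "finite F" "finite G" "finite H"
    and nonneg: "\<And>s. 0 \<le> f s" "\<And>s. 0 \<le> g s" "\<And>s. 0 \<le> h s"
    and supp: "\<And>u. u \<notin> H \<Longrightarrow> h u = 0"
    and step: "\<And>s t e. s \<in> F \<Longrightarrow> t \<in> G \<Longrightarrow> e \<in> {0, 1} \<Longrightarrow> sqrt (f s * g t) \<le> h (s + t + e)"
  shows "2 * sqrt ((\<Sum>s\<in>F. f s) * (\<Sum>t\<in>G. g t)) \<le> (\<Sum>u\<in>H. h u)"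
proof (cases "(\<Sum>s\<in>F. f s) = 0 \<or> (\<Sum>t\<in>G. g t) = 0")
  case True
  then show ?thesis by (auto intro!: sum_nonneg nonneg)
next
  case False
  then have pos: "(\<Sum>s\<in>F. f s) > 0" "(\<Sum>t\<in>G. g t) > 0"
    by (auto simp: less_le intro!: sum_nonneg nonneg)
  have ne: "F \<noteq> {}" "G \<noteq> {}" using False by auto
  define a where "a = Max (f ` F)"
  define b where "b = Max (g ` G)"
  have "a \<in> f ` F" "b \<in> g ` G"
    unfolding a_def b_def using fin ne by (intro Max_in; simp)+
  then obtain s1 t1 where st1: "s1 \<in> F" "f s1 = a" "t1 \<in> G" "g t1 = b" by auto
  have fa: "f s \<le> a" if "s \<in> F" for s unfolding a_def using fin that by auto
  have gb: "g s \<le> b" if "s \<in> G" for s unfolding b_def using fin that by auto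
  have "a \<noteq> 0"
  proof
    assume "a = 0"
    then have "(\<Sum>s\<in>F. f s) \<le> (\<Sum>s\<in>F. 0)" using fa by (intro sum_mono) auto
    with pos show False by simp
  qed
  moreover have "b \<noteq> 0"
  proof
    assume "b = 0"
    then have "(\<Sum>s\<in>G. g s) \<le> (\<Sum>s\<in>G. 0)" using gb by (intro sum_mono) auto
    with pos show False by simp
  qed
  ultimately have ab: "a > 0" "b > 0"
    using nonneg(1)[of s1] nonneg(2)[of t1] st1 by (auto simp: less_le)
  define c where "c = sqrt (a * b)"
  have "c > 0" using ab by (simp add: c_def)
  have levels: "real (card {s\<in>F. l \<le> f s / a}) + real (card {t\<in>G. l \<le> g t / b})
      \<le> real (card {u\<in>H. l \<le> h u / c})" if l: "l \<in> {0..1} - {0}" for l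
  proof -
    have "card {s\<in>F. l \<le> f s / a} + card {t\<in>G. l \<le> g t / b} \<le> card {u\<in>H. l \<le> h u / c}"
    proof (rule sumset_card_int)
      show "{s\<in>F. l \<le> f s / a} \<noteq> {}" "{t\<in>G. l \<le> g t / b} \<noteq> {}"
        using st1 ab l by auto
      fix s t e assume s: "s \<in> {s\<in>F. l \<le> f s / a}" and t: "t \<in> {t\<in>G. l \<le> g t / b}"
        and e: "e \<in> {0, 1::int}"
      have "(l * a) * (l * b) \<le> f s * g t"
        using s t ab l by (intro mult_mono) (auto simp: field_simps nonneg)
      then have "sqrt ((l * a) * (l * b)) \<le> sqrt (f s * g t)" by simp
      also have "sqrt ((l * a) * (l * b)) = l * c"
        using l by (simp add: c_def real_sqrt_mult algebra_simps)
      also have "sqrt (f s * g t) \<le> h (s + t + e)"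
        using s t e by (intro step) auto
      finally have le: "l * c \<le> h (s + t + e)" .
      moreover have "0 < l * c" using l \<open>c > 0\<close> by simp
      ultimately have "h (s + t + e) > 0" by linarith
      then show "s + t + e \<in> {u\<in>H. l \<le> h u / c}"
        using le supp[of "s + t + e"] \<open>c > 0\<close> by (auto simp: field_simps)
    qed (use fin in auto)
    then show ?thesis by linarith
  qed
  have ints: "((\<lambda>l. real (card {s\<in>F. l \<le> f s / a})) has_integral (\<Sum>s\<in>F. min (f s / a) 1)) {0..1}"
    "((\<lambda>l. real (card {t\<in>G. l \<le> g t / b})) has_integral (\<Sum>t\<in>G. min (g t / b) 1)) {0..1}"
    "((\<lambda>l. real (card {u\<in>H. l \<le> h u / c})) has_integral (\<Sum>u\<in>H. min (h u / c) 1)) {0..1}"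
    using fin nonneg ab \<open>c > 0\<close> by (auto intro!: layer_cake divide_nonneg_pos)
  have "(\<Sum>s\<in>F. f s) / a + (\<Sum>t\<in>G. g t) / b
      = (\<Sum>s\<in>F. min (f s / a) 1) + (\<Sum>t\<in>G. min (g t / b) 1)"
    unfolding sum_divide_distrib using fa gb ab
    by (intro arg_cong2[where f="(+)"] sum.cong refl) (auto simp: min_def field_simps)
  also have "\<dots> \<le> (\<Sum>u\<in>H. min (h u / c) 1)"
  \<comment> \<open>At level \<open>0\<close> the superlevel sets are all of \<open>F\<close>, \<open>G\<close> and \<open>H\<close>, and \<open>H\<close> need not contain the
    sums of points where \<open>f\<close> or \<open>g\<close> vanishes; so the integrand is set to \<open>0\<close> at this one level.\<close>
  proof (rule has_integral_le)
    show "((\<lambda>l. if l = 0 then 0 else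
        real (card {s\<in>F. l \<le> f s / a}) + real (card {t\<in>G. l \<le> g t / b})) has_integral
      (\<Sum>s\<in>F. min (f s / a) 1) + (\<Sum>t\<in>G. min (g t / b) 1)) {0..1}"
      by (rule has_integral_spike_finite[OF _ _ has_integral_add[OF ints(1,2)], of "{0}"]) auto
  qed (use ints(3) levels in auto)
  also have "\<dots> \<le> (\<Sum>u\<in>H. h u / c)" by (intro sum_mono) auto
  also have "\<dots> = (\<Sum>u\<in>H. h u) / c" by (simp add: sum_divide_distrib)
  finally have 1: "(\<Sum>s\<in>F. f s) / a + (\<Sum>t\<in>G. g t) / b \<le> (\<Sum>u\<in>H. h u) / c" .
  have "2 * sqrt ((\<Sum>s\<in>F. f s) * (\<Sum>t\<in>G. g t)) / c
      = 2 * sqrt (((\<Sum>s\<in>F. f s) / a) * ((\<Sum>t\<in>G. g t) / b))"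
    by (simp add: c_def real_sqrt_divide real_sqrt_mult)
  also have "\<dots> \<le> (\<Sum>s\<in>F. f s) / a + (\<Sum>t\<in>G. g t) / b"
    using arith_geo_mean_sqrt[of "(\<Sum>s\<in>F. f s) / a" "(\<Sum>t\<in>G. g t) / b"] pos ab by simp
  also note 1
  finally show ?thesis using \<open>c > 0\<close> by (simp add: divide_le_cancel)
qed

lemma card_fibres: "finite A \<Longrightarrow> (\<Sum>s\<in>f ` A. real (card {a\<in>A. f a = s})) = real (card A)"
  using sum.image_gen[of A "\<lambda>_. 1::real" f] by simp

text \<open>The discrete form of \<open>vol (A + B) \<ge> 2 ^ n * sqrt (vol A * vol B)\<close>, with the vertices of a lattice
  cube as thickening. The induction slices along one coordinate \<open>j\<close> and feeds the slice sizes to the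
  functional inequality. Slices are kept as sets of functions on the full index type, constant
  outside \<open>I\<close> instead of zero, and the thickening has prescribed values \<open>d\<close> outside \<open>I\<close>: thus the
  two layers \<open>e j = 0\<close> and \<open>e j = 1\<close> of the cube are both instances of the induction hypothesis,
  without any renormalisation of coordinates.\<close>

theorem discrete_brunn_minkowski:
  fixes A B C :: "('i \<Rightarrow> int) set"
  assumes "finite I" "finite A" "finite B" "finite C"
    and "\<And>a a' i. a \<in> A \<Longrightarrow> a' \<in> A \<Longrightarrow> i \<notin> I \<Longrightarrow> a i = a' i"
    and "\<And>b b' i. b \<in> B \<Longrightarrow> b' \<in> B \<Longrightarrow> i \<notin> I \<Longrightarrow> b i = b' i"
    and "\<And>a b e. a \<in> A \<Longrightarrow> b \<in> B \<Longrightarrow> (\<And>i. i \<in> I \<Longrightarrow> e i \<in> {0, 1}) \<Longrightarrow>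
      (\<And>i. i \<notin> I \<Longrightarrow> e i = d i) \<Longrightarrow> (\<lambda>i. a i + b i + e i) \<in> C"
  shows "2 ^ card I * sqrt (real (card A) * real (card B)) \<le> real (card C)"
  using assms
proof (induction I arbitrary: A B C d rule: finite_induct)
  case empty
  show ?case
  proof (cases "A = {} \<or> B = {}")
    case False
    then obtain a b where ab: "a \<in> A" "b \<in> B" by blast
    have "A = {a}" "B = {b}" using ab empty(4,5) by (auto simp: fun_eq_iff)
    moreover have "C \<noteq> {}" using empty(6)[OF ab, of d] by auto
    then have "card C \<ge> 1" using empty(3) by (simp add: Suc_leI card_gt_0_iff)
    ultimately show ?thesis by simp
  qed auto
next
  case (insert j I)
  let ?F = "(\<lambda>a. a j) ` A" and ?G = "(\<lambda>b. b j) ` B" and ?H = "(\<lambda>c. c j) ` C"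
  define f where "f s = real (card {a\<in>A. a j = s})" for s
  define g where "g t = real (card {b\<in>B. b j = t})" for t
  define h where "h u = real (card {c\<in>C. c j = u}) / 2 ^ card I" for u
  have "2 * sqrt ((\<Sum>s\<in>?F. f s) * (\<Sum>t\<in>?G. g t)) \<le> (\<Sum>u\<in>?H. h u)"
  proof (rule prekopa_leindler_int)
    show "h u = 0" if "u \<notin> ?H" for u
    proof -
      have "{c\<in>C. c j = u} = {}" using that by auto
      then show ?thesis unfolding h_def by (metis card.empty div_0 of_nat_0)
    qed
    fix s t e assume e: "e \<in> {0, 1::int}"
    have "2 ^ card I * sqrt (real (card {a\<in>A. a j = s}) * real (card {b\<in>B. b j = t}))
        \<le> real (card {c\<in>C. c j = s + t + e})"
    proof (rule insert.IH[where d = "d(j := e)"])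
      fix a b e' assume a: "a \<in> {a\<in>A. a j = s}" and b: "b \<in> {b\<in>B. b j = t}"
        and e': "\<And>i. i \<in> I \<Longrightarrow> e' i \<in> {0, 1}" "\<And>i. i \<notin> I \<Longrightarrow> e' i = (d(j := e)) i"
      have "(\<lambda>i. a i + b i + e' i) \<in> C"
      proof (rule insert.prems(6))
        fix i
        show "e' i \<in> {0, 1}" if "i \<in> insert j I"
          using that e' e by (cases "i \<in> I") auto
        show "e' i = d i" if "i \<notin> insert j I" using that e'(2)[of i] by auto
      qed (use a b in auto)
      moreover have "e' j = e" using e'(2)[of j] insert.hyps by simp
      ultimately show "(\<lambda>i. a i + b i + e' i) \<in> {c\<in>C. c j = s + t + e}"
        using a b by simp
    next
      fix a a' i assume "a \<in> {a\<in>A. a j = s}" "a' \<in> {a\<in>A. a j = s}" "i \<notin> I"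
      then show "a i = a' i" using insert.prems(4)[of a a' i] by (cases "i = j") auto
    next
      fix b b' i assume "b \<in> {b\<in>B. b j = t}" "b' \<in> {b\<in>B. b j = t}" "i \<notin> I"
      then show "b i = b' i" using insert.prems(5)[of b b' i] by (cases "i = j") auto
    qed (use insert.prems in auto)
    then show "sqrt (f s * g t) \<le> h (s + t + e)"
      by (simp add: f_def g_def h_def field_simps)
  qed (use insert.prems in \<open>auto simp: f_def g_def h_def\<close>)
  also have "(\<Sum>u\<in>?H. h u) = real (card C) / 2 ^ card I"
    unfolding h_def using card_fibres[OF insert.prems(3), of "\<lambda>c. c j"]
    by (simp flip: sum_divide_distrib)
  also have "(\<Sum>s\<in>?F. f s) = real (card A)"
    unfolding f_def by (intro card_fibres insert.prems)
  also have "(\<Sum>t\<in>?G. g t) = real (card B)"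
    unfolding g_def by (intro card_fibres insert.prems)
  finally show ?case using insert.hyps by (simp add: field_simps)
qed

section \<open>Counting lattice points in balls\<close>

text \<open>Volumes in the span of \<open>B\<close> are replaced by numbers of points of the lattice spanned by \<open>B\<close>.
  Lattice points are identified with their coordinates so that the discrete Brunn-Minkowski
  inequality applies to them; the balls belong to the norm of the ambient space.\<close>

definition lattice_vec :: "'a::real_vector set \<Rightarrow> ('a \<Rightarrow> int) \<Rightarrow> 'a" where
  "lattice_vec B z = (\<Sum>b\<in>B. of_int (z b) *\<^sub>R b)"

definition lattice_ball :: "'a::real_normed_vector set \<Rightarrow> real \<Rightarrow> ('a \<Rightarrow> int) set" where
  "lattice_ball B T = {z. (\<forall>b. b \<notin> B \<longrightarrow> z b = 0) \<and> norm (lattice_vec B z) < T}"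

lemma lattice_vec_add: "lattice_vec B (\<lambda>i. z i + w i) = lattice_vec B z + lattice_vec B w"
  by (simp add: lattice_vec_def scaleR_add_left sum.distrib)

lemma lattice_vec_uminus: "lattice_vec B (\<lambda>i. - z i) = - lattice_vec B z"
  by (simp add: lattice_vec_def sum_negf)

lemma norm_sum_scaleR_le:
  assumes "\<And>b. b \<in> B \<Longrightarrow> \<bar>u b\<bar> \<le> M"
  shows "norm (\<Sum>b\<in>B. u b *\<^sub>R (b::'a::real_normed_vector)) \<le> M * (\<Sum>b\<in>B. norm b)"
proof -
  have "norm (\<Sum>b\<in>B. u b *\<^sub>R b) \<le> (\<Sum>b\<in>B. M * norm b)"
    by (rule sum_norm_le) (simp add: assms mult_right_mono)
  then show ?thesis by (simp add: sum_distrib_left)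
qed

lemma finite_lattice_ball:
  assumes "finite B" "independent (B :: 'a::real_normed_vector set)"
  shows "finite (lattice_ball B T)"
proof -
  obtain c where c: "c > 0" "\<And>u b. b \<in> B \<Longrightarrow> \<bar>u b\<bar> \<le> c * norm (\<Sum>b\<in>B. u b *\<^sub>R b)"
    using independent_coordinates_bounded[OF assms] by metis
  let ?M = "\<lceil>c * T\<rceil>"
  have "lattice_ball B T \<subseteq> {z. \<forall>b. (b \<in> B \<longrightarrow> z b \<in> {- ?M..?M}) \<and> (b \<notin> B \<longrightarrow> z b = 0)}"
  proof clarify
    fix z b assume z: "z \<in> lattice_ball B T"
    have "z b \<in> {- ?M..?M}" if "b \<in> B"
    proof -
      have "\<bar>real_of_int (z b)\<bar> \<le> c * norm (lattice_vec B z)"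
        using c(2)[OF that, of "\<lambda>b. of_int (z b)"] by (simp add: lattice_vec_def)
      also have "\<dots> \<le> c * T" using z c(1) by (simp add: lattice_ball_def)
      finally show ?thesis by (simp add: abs_le_iff) linarith
    qed
    then show "(b \<in> B \<longrightarrow> z b \<in> {- ?M..?M}) \<and> (b \<notin> B \<longrightarrow> z b = 0)"
      using z by (auto simp: lattice_ball_def)
  qed
  then show ?thesis
    by (rule finite_subset) (intro finite_set_of_finite_funs assms; simp)
qed

lemma card_lattice_ball_mono:
  assumes "finite B" "independent (B :: 'a::real_normed_vector set)" "S \<le> T"
  shows "card (lattice_ball B S) \<le> card (lattice_ball B T)"
  by (rule card_mono[OF finite_lattice_ball[OF assms(1,2)]])
     (use assms(3) in \<open>auto simp: lattice_ball_def\<close>)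

lemma card_lattice_ball_pos:
  assumes "finite B" "independent (B :: 'a::real_normed_vector set)" "T > 0"
  shows "card (lattice_ball B T) > 0"
proof -
  have "(\<lambda>_. 0) \<in> lattice_ball B T" using assms by (simp add: lattice_ball_def lattice_vec_def)
  then show ?thesis using finite_lattice_ball[OF assms(1,2)] by (auto simp: card_gt_0_iff)
qed

text \<open>The upper half of the scaling law for volumes: division with remainder by \<open>m\<close> maps a lattice
  point of the large ball to one of the small ball, enlarged by a bound for the norm on a lattice
  cell, with \<open>m\<close> possible remainders in each coordinate.\<close>

lemma card_lattice_ball_dilate:
  fixes B :: "'a::real_normed_vector set" and m :: nat
  assumes fin: "finite B" "independent B" and m: "m \<ge> 1"
  shows "card (lattice_ball B (real m * T))
    \<le> m ^ card B * card (lattice_ball B (T + (\<Sum>b\<in>B. norm b)))"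
proof -
  let ?C = "\<Sum>b\<in>B. norm b"
  let ?R = "PiE B (\<lambda>_. {0..<int m})"
  define \<Phi> where "\<Phi> z = (restrict (\<lambda>b. z b mod int m) B, \<lambda>b. z b div int m)" for z :: "'a \<Rightarrow> int"
  have "inj_on \<Phi> (lattice_ball B (real m * T))"
  proof (rule inj_onI)
    fix z w assume z: "z \<in> lattice_ball B (real m * T)" and w: "w \<in> lattice_ball B (real m * T)"
      and eq: "\<Phi> z = \<Phi> w"
    show "z = w"
    proof
      fix b
      show "z b = w b"
      proof (cases "b \<in> B")
        case True
        have "z b mod int m = w b mod int m"
          using eq True by (auto simp: \<Phi>_def fun_eq_iff restrict_def split: if_splits)
        moreover have "z b div int m = w b div int m"
          using eq by (auto simp: \<Phi>_def fun_eq_iff)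
        ultimately show ?thesis by (metis div_mult_mod_eq)
      qed (use z w in \<open>auto simp: lattice_ball_def\<close>)
    qed
  qed
  moreover have "\<Phi> ` lattice_ball B (real m * T) \<subseteq> ?R \<times> lattice_ball B (T + ?C)"
  proof clarify
    fix z r q assume z: "z \<in> lattice_ball B (real m * T)" and "(r, q) = \<Phi> z"
    then have q: "q = (\<lambda>b. z b div int m)" and r: "r = restrict (\<lambda>b. z b mod int m) B"
      by (auto simp: \<Phi>_def)
    have "lattice_vec B z = (\<Sum>b\<in>B. of_int (int m * (z b div int m) + z b mod int m) *\<^sub>R b)"
      unfolding lattice_vec_def by (intro sum.cong refl) (metis mult_div_mod_eq)
    also have "\<dots> = real m *\<^sub>R lattice_vec B q + lattice_vec B (\<lambda>b. z b mod int m)"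
      by (simp only: lattice_vec_def q of_int_add of_int_mult of_int_of_nat_eq scaleR_add_left
          sum.distrib scaleR_sum_right scaleR_scaleR)
    finally have "real m *\<^sub>R lattice_vec B q
        = lattice_vec B z - lattice_vec B (\<lambda>b. z b mod int m)"
      by simp
    then have "real m * norm (lattice_vec B q)
        = norm (lattice_vec B z - lattice_vec B (\<lambda>b. z b mod int m))"
      by (metis abs_of_nat norm_scaleR)
    also have "\<dots> \<le> norm (lattice_vec B z) + norm (lattice_vec B (\<lambda>b. z b mod int m))"
      by (rule norm_triangle_ineq4)
    also have "norm (lattice_vec B (\<lambda>b. z b mod int m)) \<le> real m * ?C"
      unfolding lattice_vec_def
    proof (rule norm_sum_scaleR_le)
      fix b
      have "0 \<le> z b mod int m" "z b mod int m < int m" using m by auto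
      then show "\<bar>real_of_int (z b mod int m)\<bar> \<le> real m" by linarith
    qed
    also have "norm (lattice_vec B z) < real m * T" using z by (simp add: lattice_ball_def)
    finally have "real m * norm (lattice_vec B q) < real m * (T + ?C)"
      by (simp add: algebra_simps)
    then have "norm (lattice_vec B q) < T + ?C" using m by simp
    then have "q \<in> lattice_ball B (T + ?C)" using z by (auto simp: lattice_ball_def q)
    moreover have "r \<in> ?R" using m by (auto simp: r)
    ultimately show "r \<in> ?R \<and> q \<in> lattice_ball B (T + ?C)" by blast
  qed
  ultimately have "card (lattice_ball B (real m * T)) \<le> card (?R \<times> lattice_ball B (T + ?C))"
    by (intro card_inj_on_le) (auto intro!: finite_PiE finite_lattice_ball fin)
  also have "\<dots> = m ^ card B * card (lattice_ball B (T + ?C))"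
    using fin by (simp add: card_cartesian_product card_PiE)
  finally show ?thesis .
qed

text \<open>Makes boundary effects negligible at suitable large radii. If enlarging the radius by a constant
  always multiplied the count by more than \<open>1 + \<eta>\<close>, the count would grow exponentially, whereas
  doubling the radius costs at most the factor \<open>2 ^ card B\<close>, up to one such enlargement.\<close>

lemma lattice_ball_slow_growth:
  fixes B :: "'a::real_normed_vector set"
  assumes fin: "finite B" "independent B" and "\<eta> > 0"
  shows "\<exists>\<tau>>0. \<tau> \<ge> \<tau>0 \<and>
    real (card (lattice_ball B (\<tau> + c))) \<le> (1 + \<eta>) * real (card (lattice_ball B \<tau>))"
proof (rule ccontr)
  assume no: "\<not> ?thesis"
  define G where "G T = real (card (lattice_ball B T))" for T
  have mono: "G S \<le> G T" if "S \<le> T" for S T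
    unfolding G_def using card_lattice_ball_mono[OF fin that] by simp
  define C where "C = (\<Sum>b\<in>B. norm b)"
  define c' where "c' = max c (C + 1)"
  have C: "C \<ge> 0" by (simp add: C_def sum_nonneg)
  have c': "c' \<ge> c" "c' \<ge> C" "c' > 0" using C by (auto simp: c'_def)
  define \<tau>1 where "\<tau>1 = max \<tau>0 1"
  have grow: "(1 + \<eta>) * G \<tau> \<le> G (\<tau> + c')" if "\<tau> \<ge> \<tau>1" for \<tau>
  proof -
    have "\<not> G (\<tau> + c) \<le> (1 + \<eta>) * G \<tau>"
      using no that by (auto simp: G_def \<tau>1_def)
    then show ?thesis using mono[of "\<tau> + c" "\<tau> + c'"] c' by simp
  qed
  have iter: "(1 + \<eta>) ^ j * G \<tau> \<le> G (\<tau> + real j * c')" if "\<tau> \<ge> \<tau>1" for \<tau> j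
  proof (induction j)
    case (Suc j)
    have "(1 + \<eta>) ^ Suc j * G \<tau> = (1 + \<eta>) * ((1 + \<eta>) ^ j * G \<tau>)" by simp
    also have "\<dots> \<le> (1 + \<eta>) * G (\<tau> + real j * c')"
      using Suc \<open>\<eta> > 0\<close> by (intro mult_left_mono) auto
    also have "\<dots> \<le> G (\<tau> + real j * c' + c')"
      using that c' by (intro grow) (simp add: add_increasing2)
    finally show ?case by (simp add: algebra_simps)
  qed simp
  have "(1 + \<eta>) ^ j \<le> 2 ^ card B" for j
  proof -
    define \<tau> where "\<tau> = \<tau>1 + (real j + 1) * c'"
    have \<tau>: "\<tau> \<ge> \<tau>1" "\<tau>1 \<ge> 1" using c' by (auto simp: \<tau>_def \<tau>1_def)
    have "(1 + \<eta>) ^ j * G (\<tau> + c') \<le> G (\<tau> + c' + real j * c')"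
      using \<tau> c' by (intro iter) auto
    also have "\<dots> \<le> G (real 2 * \<tau>)"
      using \<tau> by (intro mono) (simp add: \<tau>_def algebra_simps)
    also have "\<dots> \<le> 2 ^ card B * G (\<tau> + C)"
      using of_nat_mono[OF card_lattice_ball_dilate[OF fin, of 2 \<tau>], where ?'a = real]
      by (simp add: G_def C_def)
    also have "\<dots> \<le> 2 ^ card B * G (\<tau> + c')"
      using c' by (intro mult_left_mono mono) auto
    finally show ?thesis
      using card_lattice_ball_pos[OF fin, of "\<tau> + c'"] \<tau> c' by (simp add: G_def)
  qed
  moreover obtain j where "2 ^ card B < (1 + \<eta>) ^ j"
    using real_arch_pow[of "1 + \<eta>"] \<open>\<eta> > 0\<close> by auto
  ultimately show False by (meson not_le)
qed

section \<open>Packing and covering sets of given diameter\<close>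

text \<open>An isodiametric packing bound. The balls of radius \<open>r / 2\<close> about the points of \<open>W\<close> are disjoint
  and their union \<open>X\<close> has diameter at most \<open>D + r\<close>, so \<open>X - X\<close> lies in a ball of radius \<open>D + r\<close>
  about the origin, while Brunn-Minkowski makes it at least \<open>2 ^ n\<close> times as large as \<open>X\<close>.
  Comparing volumes gives \<open>(1 + D / r) ^ n\<close>, whereas a ball about a point of \<open>W\<close> that contains \<open>W\<close>
  would only yield \<open>(1 + 2 * D / r) ^ n\<close>. In the lattice version the ratio \<open>\<kappa>\<close> of the radii is
  rounded up to an integer \<open>m\<close> before dilating, which turns \<open>1 + D / r\<close> into at most
  \<open>3 / 2 + D / r\<close>, less than the stated \<open>2 + D / r\<close>. Rounding points to the lattice moves them by at most \<open>C\<close>, so everything is done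
  at a scale \<open>T\<close> at which the lattice count barely changes when the radius grows by \<open>C\<close>.\<close>

theorem card_separated_le:
  fixes B W :: "'a::real_normed_vector set"
  assumes fin: "finite B" "independent B" and W: "finite W" "W \<subseteq> span B" and r: "r > 0"
    and sep: "\<And>x y. x \<in> W \<Longrightarrow> y \<in> W \<Longrightarrow> x \<noteq> y \<Longrightarrow> r \<le> norm (x - y)"
    and diam: "\<And>x y. x \<in> W \<Longrightarrow> y \<in> W \<Longrightarrow> norm (x - y) \<le> D"
    and D: "D \<ge> 0"
  shows "real (card W) \<le> (2 + D / r) ^ card B"
proof -
  define n where "n = card B"
  define C where "C = (\<Sum>b\<in>B. norm b)"
  define G where "G T = real (card (lattice_ball B T))" for T
  define \<kappa> where "\<kappa> = 2 * (1 + D / r)"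
  define m where "m = nat (\<lfloor>\<kappa>\<rfloor> + 1)"
  define C' where "C' = C * (2 * D / r + 3)"
  have C: "C \<ge> 0" by (simp add: C_def sum_nonneg)
  have \<kappa>: "\<kappa> \<ge> 2" using D r by (simp add: \<kappa>_def)
  then have m: "real m > \<kappa>" "real m \<le> \<kappa> + 1" "m \<ge> 1" unfolding m_def by linarith+
  have "\<exists>u. x = (\<Sum>b\<in>B. u b *\<^sub>R b)" if "x \<in> W" for x
    using that W(2) span_finite[OF fin(1)] by auto
  then obtain u where u: "\<And>x. x \<in> W \<Longrightarrow> x = (\<Sum>b\<in>B. u x b *\<^sub>R b)" by metis
  have main: "real (card W) \<le> (1 + \<eta>) * (real m / 2) ^ n" if "\<eta> > 0" for \<eta>
  proof -
    obtain \<tau> where \<tau>: "\<tau> > 0" "\<tau> \<ge> C' / (real m - \<kappa>)" "G (\<tau> + C) \<le> (1 + \<eta>) * G \<tau>"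
      using lattice_ball_slow_growth[OF fin \<open>\<eta> > 0\<close>] unfolding G_def by blast
    \<comment> \<open>With this scale the balls of radius \<open>\<tau>\<close> about the rounded points stay disjoint: rounding two
      points brings them closer by at most \<open>2 * C\<close>.\<close>
    define T where "T = 2 * (\<tau> + C) / r"
    have T: "T > 0" "T * r = 2 * (\<tau> + C)" using \<tau> C r by (auto simp: T_def)
    define z where "z x b = (if b \<in> B then \<lfloor>T * u x b\<rfloor> else 0)" for x b
    have round: "norm (T *\<^sub>R x - lattice_vec B (z x)) \<le> C" if "x \<in> W" for x
    proof -
      have "T *\<^sub>R x - lattice_vec B (z x) = (\<Sum>b\<in>B. (T * u x b - of_int \<lfloor>T * u x b\<rfloor>) *\<^sub>R b)"
        by (subst u[OF that]) (simp add: lattice_vec_def z_def scaleR_sum_right scaleR_diff_left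
            sum_subtractf)
      also have "norm \<dots> \<le> 1 * C"
        unfolding C_def by (rule norm_sum_scaleR_le) linarith
      finally show ?thesis by simp
    qed
    have round2: "\<bar>norm (lattice_vec B (z x) - lattice_vec B (z y)) - T * norm (x - y)\<bar> \<le> 2 * C"
      if "x \<in> W" "y \<in> W" for x y
    proof -
      have "\<bar>norm (lattice_vec B (z x) - lattice_vec B (z y)) - norm (T *\<^sub>R (x - y))\<bar>
          \<le> norm ((lattice_vec B (z x) - lattice_vec B (z y)) - T *\<^sub>R (x - y))"
        by (rule norm_triangle_ineq3)
      also have "\<dots> = norm ((T *\<^sub>R y - lattice_vec B (z y)) - (T *\<^sub>R x - lattice_vec B (z x)))"
        by (simp add: algebra_simps)
      also have "\<dots> \<le> C + C"
        by (intro order_trans[OF norm_triangle_ineq4] add_mono round that)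
      finally show ?thesis using T by simp
    qed
    define s where "s = (\<lambda>(x, w) i. z x i + w i :: int)"
    define X where "X = s ` (W \<times> lattice_ball B \<tau>)"
    have fl: "finite (lattice_ball B t)" for t by (rule finite_lattice_ball[OF fin])
    have finX: "finite X" unfolding X_def using W fl by simp
    have "inj_on s (W \<times> lattice_ball B \<tau>)"
    proof (rule inj_onI, clarify)
      fix x w y v assume x: "x \<in> W" and y: "y \<in> W"
        and w: "w \<in> lattice_ball B \<tau>" and v: "v \<in> lattice_ball B \<tau>" and eq: "s (x, w) = s (y, v)"
      have sum_eq: "lattice_vec B (z x) + lattice_vec B w = lattice_vec B (z y) + lattice_vec B v"
        using eq by (simp add: s_def flip: lattice_vec_add)
      have "x = y"
      proof (rule ccontr)
        assume "x \<noteq> y"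
        have "lattice_vec B (z x) - lattice_vec B (z y) = lattice_vec B v - lattice_vec B w"
          using sum_eq by (simp add: algebra_simps)
        also have "norm \<dots> < 2 * \<tau>"
          using norm_triangle_ineq4[of "lattice_vec B v" "lattice_vec B w"] v w
          by (simp add: lattice_ball_def)
        finally have "T * norm (x - y) < 2 * \<tau> + 2 * C" using round2[OF x y] by linarith
        also have "2 * \<tau> + 2 * C = T * r" using T(2) by simp
        also have "\<dots> \<le> T * norm (x - y)"
          using sep[OF x y \<open>x \<noteq> y\<close>] T(1) by (intro mult_left_mono) auto
        finally show False by simp
      qed
      moreover have "w = v"
        using eq \<open>x = y\<close> by (simp add: s_def fun_eq_iff)
      ultimately show "x = y \<and> w = v" by simp
    qed
    then have cardX: "real (card X) = real (card W) * G \<tau>"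
      by (simp add: X_def G_def card_image card_cartesian_product)
    have X0: "a i = 0" if "a \<in> X" "i \<notin> B" for a i
      using that by (auto simp: X_def s_def z_def lattice_ball_def)
    let ?Y = "(\<lambda>a i. - a i) ` X"
    have cardY: "card ?Y = card X" by (rule card_image) (auto simp: inj_on_def fun_eq_iff)
    have "2 ^ card B * sqrt (real (card X) * real (card ?Y))
        \<le> real (card (lattice_ball B (real m * \<tau>)))"
    proof (rule discrete_brunn_minkowski[where d = "\<lambda>_. 0"])
      fix a b e
      assume a: "a \<in> X" and b: "b \<in> ?Y" and e: "\<And>i. i \<in> B \<Longrightarrow> e i \<in> {0, 1::int}"
        "\<And>i. i \<notin> B \<Longrightarrow> e i = 0"
      obtain x w where x: "x \<in> W" "w \<in> lattice_ball B \<tau>" "a = (\<lambda>i. z x i + w i)"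
        using a by (auto simp: X_def s_def)
      obtain y v where y: "y \<in> W" "v \<in> lattice_ball B \<tau>" "b = (\<lambda>i. - (z y i + v i))"
        using b by (auto simp: X_def s_def)
      have "lattice_vec B (\<lambda>i. a i + b i + e i)
          = (lattice_vec B (z x) - lattice_vec B (z y)) + lattice_vec B w - lattice_vec B v
            + lattice_vec B e"
        by (simp only: x(3) y(3) lattice_vec_add lattice_vec_uminus) simp
      also have "norm \<dots> \<le> norm (lattice_vec B (z x) - lattice_vec B (z y))
          + norm (lattice_vec B w) + norm (lattice_vec B v) + norm (lattice_vec B e)"
        by (intro order_trans[OF norm_triangle_ineq] order_trans[OF norm_triangle_ineq4] add_mono
              order_refl)
      also have "norm (lattice_vec B (z x) - lattice_vec B (z y)) \<le> T * norm (x - y) + 2 * C"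
        using round2[OF x(1) y(1)] by linarith
      also have "T * norm (x - y) \<le> T * D" using diam[OF x(1) y(1)] T by simp
      also have "norm (lattice_vec B w) < \<tau>" using x by (simp add: lattice_ball_def)
      also have "norm (lattice_vec B v) < \<tau>" using y by (simp add: lattice_ball_def)
      also have "norm (lattice_vec B e) \<le> 1 * C"
        unfolding C_def lattice_vec_def
      proof (rule norm_sum_scaleR_le)
        fix b assume "b \<in> B"
        then show "\<bar>real_of_int (e b)\<bar> \<le> 1" using e(1)[of b] by auto
      qed
      also have "T * D + 2 * C + \<tau> + \<tau> + 1 * C = \<kappa> * \<tau> + C'"
        using r by (simp add: T_def \<kappa>_def C'_def field_simps)
      also have "\<dots> \<le> real m * \<tau>"
        using \<tau>(2) m(1) by (simp add: field_simps)
      finally have "norm (lattice_vec B (\<lambda>i. a i + b i + e i)) < real m * \<tau>" by simp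
      moreover have "b i = 0" if "i \<notin> B" for i using b X0 that by auto
      ultimately show "(\<lambda>i. a i + b i + e i) \<in> lattice_ball B (real m * \<tau>)"
        using X0[OF a] e(2) by (simp add: lattice_ball_def)
    next
      fix a a' i assume "a \<in> X" "a' \<in> X" "i \<notin> B"
      then show "a i = a' i" by (simp add: X0)
    next
      fix b b' i assume "b \<in> ?Y" "b' \<in> ?Y" "i \<notin> B"
      then show "b i = b' i" by (auto simp: X0)
    qed (use fin finX fl in auto)
    also have "sqrt (real (card X) * real (card ?Y)) = real (card W) * G \<tau>"
      by (simp add: cardY cardX G_def)
    also have "real (card (lattice_ball B (real m * \<tau>))) \<le> real m ^ n * G (\<tau> + C)"
      using of_nat_mono[OF card_lattice_ball_dilate[OF fin m(3), of \<tau>], where ?'a = real]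
      by (simp add: G_def C_def n_def)
    also have "\<dots> \<le> real m ^ n * ((1 + \<eta>) * G \<tau>)" by (intro mult_left_mono \<tau>) simp
    finally have "2 ^ n * real (card W) * G \<tau> \<le> real m ^ n * (1 + \<eta>) * G \<tau>"
      by (simp add: n_def mult_ac)
    moreover have "G \<tau> > 0" using card_lattice_ball_pos[OF fin \<tau>(1)] by (simp add: G_def)
    ultimately have "2 ^ n * real (card W) \<le> real m ^ n * (1 + \<eta>)" by simp
    then show ?thesis by (simp add: power_divide field_simps)
  qed
  have pos: "(real m / 2) ^ n > 0" using m by simp
  have "real (card W) \<le> (real m / 2) ^ n"
  proof (rule field_le_epsilon)
    fix e :: real assume "e > 0"
    then have "real (card W) \<le> (1 + e / (real m / 2) ^ n) * (real m / 2) ^ n"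
      using pos by (intro main divide_pos_pos)
    also have "\<dots> = (real m / 2) ^ n + e" using m(3) by (simp add: distrib_right)
    finally show "real (card W) \<le> (real m / 2) ^ n + e" .
  qed
  also have "\<dots> \<le> (2 + D / r) ^ n"
  proof (rule power_mono)
    have "real m / 2 \<le> (\<kappa> + 1) / 2" using m(2) by simp
    also have "\<dots> \<le> 2 + D / r" using r by (simp add: \<kappa>_def field_simps)
    finally show "real m / 2 \<le> 2 + D / r" .
  qed simp
  finally show ?thesis by (simp add: n_def)
qed

text \<open>A separated subset of greatest cardinality is a net, and the packing bound ensures that one
  exists.\<close>

corollary finite_net_of_bounded_diameter:
  fixes B F :: "'a::real_normed_vector set"
  assumes fin: "finite B" "independent B" and F: "F \<subseteq> span B" and r: "r > 0" and D: "D \<ge> 0"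
    and diam: "\<And>x y. x \<in> F \<Longrightarrow> y \<in> F \<Longrightarrow> norm (x - y) \<le> D"
  shows "\<exists>W. finite W \<and> W \<subseteq> F \<and> real (card W) \<le> (2 + D / r) ^ card B \<and>
    (\<forall>x\<in>F. \<exists>w\<in>W. norm (x - w) < r)"
proof -
  define sep where "sep W \<longleftrightarrow> finite W \<and> W \<subseteq> F \<and>
    (\<forall>x\<in>W. \<forall>y\<in>W. x \<noteq> y \<longrightarrow> r \<le> norm (x - y))" for W
  have bound: "real (card W) \<le> (2 + D / r) ^ card B" if "sep W" for W
    using that F diam by (intro card_separated_le fin r D) (auto simp: sep_def)
  have "sep {}" by (simp add: sep_def)
  moreover have "\<forall>W. sep W \<longrightarrow> card W < Suc (nat \<lfloor>(2 + D / r) ^ card B\<rfloor>)"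
    using bound by (auto simp: le_nat_floor less_Suc_eq_le)
  ultimately have "\<exists>W. sep W \<and> (\<forall>V. sep V \<longrightarrow> card V \<le> card W)"
    by (rule ex_has_greatest_nat)
  then obtain W where W: "sep W" "\<And>V. sep V \<Longrightarrow> card V \<le> card W" by blast
  have "\<exists>w\<in>W. norm (x - w) < r" if "x \<in> F" for x
  proof (rule ccontr)
    assume far: "\<not> (\<exists>w\<in>W. norm (x - w) < r)"
    then have "x \<notin> W" using r by force
    moreover have "sep (insert x W)"
      using W(1) far that by (auto simp: sep_def not_less norm_minus_commute)
    ultimately show False using W(2)[of "insert x W"] W(1) by (auto simp: sep_def)
  qed
  then show ?thesis using W(1) bound[OF W(1)] by (auto simp: sep_def)
qed

section \<open>Covers by sets of small diameter\<close>

text \<open>Covers consist of sets of small diameter rather than balls: estimates for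
  differences of points of an attractor do not reach the centre of a ball outside it.\<close>

definition small_cover :: "'a::real_normed_vector set \<Rightarrow> real \<Rightarrow> real \<Rightarrow> bool" where
  "small_cover K d N \<longleftrightarrow> (\<exists>\<U>. finite \<U> \<and> real (card \<U>) \<le> N \<and> K \<subseteq> \<Union>\<U> \<and>
     (\<forall>U\<in>\<U>. \<forall>x\<in>U. \<forall>y\<in>U. norm (x - y) \<le> d))"

text \<open>One step of the dynamics. The image of a covering set under \<open>P \<circ> T\<close> has diameter at most \<open>L * d\<close>
  and lies in a space of dimension \<open>card B\<close>; it is split into pieces of diameter \<open>a * d\<close>. On the
  corresponding pieces of the image under \<open>T\<close> the complementary component contributes at most
  \<open>q * d\<close>.\<close>

lemma small_cover_image:
  fixes T P :: "'a::real_normed_vector \<Rightarrow> 'a"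
  assumes cov: "small_cover K d N" and d: "d > 0"
    and fin: "finite B" "independent B" and P: "range P \<subseteq> span B"
    and a: "a > 0" and L: "L \<ge> 0"
    and low: "\<And>x y. x \<in> K \<Longrightarrow> y \<in> K \<Longrightarrow> norm (P (T x) - P (T y)) \<le> L * norm (x - y)"
    and q: "q \<ge> 0"
    and high: "\<And>x y. x \<in> K \<Longrightarrow> y \<in> K \<Longrightarrow>
      norm ((T x - P (T x)) - (T y - P (T y))) \<le> q * norm (x - y)"
  shows "small_cover (T ` K) ((a + q) * d) (N * (2 + 2 * L / a) ^ card B)"
proof -
  obtain \<U> where \<U>: "finite \<U>" "real (card \<U>) \<le> N" "K \<subseteq> \<Union>\<U>"
    "\<And>U x y. U \<in> \<U> \<Longrightarrow> x \<in> U \<Longrightarrow> y \<in> U \<Longrightarrow> norm (x - y) \<le> d"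
    using cov unfolding small_cover_def by blast
  \<comment> \<open>A piece within distance \<open>r\<close> of a point has diameter \<open>2 * r\<close>.\<close>
  define r where "r = a * d / 2"
  let ?k = "(2 + 2 * L / a) ^ card B"
  have r: "r > 0" using a d by (simp add: r_def)
  have ratio: "L * d / r = 2 * L / a" using a d by (simp add: r_def)
  have "\<exists>W. finite W \<and> real (card W) \<le> ?k \<and>
      (\<forall>x\<in>U \<inter> K. \<exists>w\<in>W. norm (P (T x) - w) < r)" if U: "U \<in> \<U>" for U
  proof -
    let ?F = "(\<lambda>x. P (T x)) ` (U \<inter> K)"
    have "\<exists>W. finite W \<and> W \<subseteq> ?F \<and> real (card W) \<le> (2 + L * d / r) ^ card B \<and>
      (\<forall>p\<in>?F. \<exists>w\<in>W. norm (p - w) < r)"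
    proof (rule finite_net_of_bounded_diameter[OF fin])
      show "?F \<subseteq> span B" using P by auto
      show "0 \<le> L * d" using L d by simp
      fix p p' assume "p \<in> ?F" "p' \<in> ?F"
      then obtain x y where xy: "x \<in> U" "x \<in> K" "y \<in> U" "y \<in> K" "p = P (T x)" "p' = P (T y)"
        by blast
      have "norm (p - p') \<le> L * norm (x - y)" using low xy by simp
      also have "\<dots> \<le> L * d" using \<U>(4)[OF U xy(1,3)] L by (rule mult_left_mono)
      finally show "norm (p - p') \<le> L * d" .
    qed (rule r)
    then show ?thesis unfolding ratio by blast
  qed
  then obtain W where W: "\<And>U. U \<in> \<U> \<Longrightarrow> finite (W U)" "\<And>U. U \<in> \<U> \<Longrightarrow> real (card (W U)) \<le> ?k"
    "\<And>U x. U \<in> \<U> \<Longrightarrow> x \<in> U \<inter> K \<Longrightarrow> \<exists>w\<in>W U. norm (P (T x) - w) < r"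
    by metis
  define piece where "piece U w = T ` {x \<in> U \<inter> K. norm (P (T x) - w) < r}" for U w
  define \<V> where "\<V> = (\<Union>U\<in>\<U>. piece U ` W U)"
  have "finite \<V>" unfolding \<V>_def using \<U>(1) W(1) by blast
  moreover have "real (card \<V>) \<le> N * ?k"
  proof -
    have "card \<V> \<le> (\<Sum>U\<in>\<U>. card (piece U ` W U))"
      unfolding \<V>_def by (rule card_UN_le[OF \<U>(1)])
    also have "\<dots> \<le> (\<Sum>U\<in>\<U>. card (W U))" by (intro sum_mono card_image_le W)
    finally have "real (card \<V>) \<le> (\<Sum>U\<in>\<U>. real (card (W U)))"
      by (metis of_nat_le_iff of_nat_sum)
    also have "\<dots> \<le> (\<Sum>U\<in>\<U>. ?k)" by (intro sum_mono W)
    also have "\<dots> = real (card \<U>) * ?k" by simp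
    also have "\<dots> \<le> N * ?k" using \<U>(2) a L by (intro mult_right_mono) auto
    finally show ?thesis .
  qed
  moreover have "T ` K \<subseteq> \<Union>\<V>"
  proof clarify
    fix x assume "x \<in> K"
    then obtain U where "U \<in> \<U>" "x \<in> U \<inter> K" using \<U>(3) by blast
    moreover from this obtain w where "w \<in> W U" "norm (P (T x) - w) < r" using W(3) by blast
    ultimately show "T x \<in> \<Union>\<V>" unfolding \<V>_def piece_def by blast
  qed
  moreover have "norm (p - p') \<le> (a + q) * d"
    if V: "V \<in> \<V>" and pp: "p \<in> V" "p' \<in> V" for V p p'
  proof -
    obtain U w where U: "U \<in> \<U>" "V = piece U w" using V unfolding \<V>_def by blast
    obtain x y where x: "x \<in> U" "x \<in> K" "norm (P (T x) - w) < r" "p = T x"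
      and y: "y \<in> U" "y \<in> K" "norm (P (T y) - w) < r" "p' = T y"
      using pp U(2) unfolding piece_def by blast
    have "p - p' = (P (T x) - w) - (P (T y) - w) + ((T x - P (T x)) - (T y - P (T y)))"
      using x y by simp
    also have "norm \<dots> \<le> norm (P (T x) - w) + norm (P (T y) - w)
        + norm ((T x - P (T x)) - (T y - P (T y)))"
      by (meson add_right_mono norm_triangle_ineq norm_triangle_ineq4 order_trans)
    also have "norm ((T x - P (T x)) - (T y - P (T y))) \<le> q * norm (x - y)"
      by (rule high) fact+
    also have "q * norm (x - y) \<le> q * d" using \<U>(4)[OF U(1) x(1) y(1)] q by (rule mult_left_mono)
    finally have "norm (p - p') \<le> 2 * r + q * d" using x(3) y(3) by linarith
    then show ?thesis by (simp add: r_def algebra_simps)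
  qed
  ultimately show ?thesis unfolding small_cover_def by blast
qed

section \<open>Fractal dimension from geometric covers\<close>

lemma covering_number_le:
  assumes "small_cover K d N" "0 \<le> d" "d < \<epsilon>"
  shows "real (covering_number \<epsilon> K) \<le> N"
proof -
  obtain \<U> where \<U>: "finite \<U>" "real (card \<U>) \<le> N" "K \<subseteq> \<Union>\<U>"
    "\<And>U x y. U \<in> \<U> \<Longrightarrow> x \<in> U \<Longrightarrow> y \<in> U \<Longrightarrow> norm (x - y) \<le> d"
    using assms(1) unfolding small_cover_def by blast
  \<comment> \<open>A set of diameter \<open>d\<close> lies in an open ball about any of its points as soon as the radius
    exceeds \<open>d\<close>; the empty set gets an arbitrary ball.\<close>
  define r where "r = (d + \<epsilon>) / 2"
  have r: "0 < r" "r < \<epsilon>" "d < r" using assms(2,3) by (auto simp: r_def)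
  define \<B> where "\<B> = (\<lambda>U. ball (SOME x. x \<in> U) r) ` \<U>"
  have "K \<subseteq> \<Union>\<B>"
  proof
    fix x assume "x \<in> K"
    then obtain U where U: "U \<in> \<U>" "x \<in> U" using \<U>(3) by blast
    then have "norm ((SOME x. x \<in> U) - x) \<le> d" by (intro \<U>(4)) (auto intro: someI)
    then have "x \<in> ball (SOME x. x \<in> U) r" using r(3) by (simp add: dist_norm)
    then show "x \<in> \<Union>\<B>" using U(1) unfolding \<B>_def by blast
  qed
  then have "covering_number \<epsilon> K \<le> card \<B>"
    unfolding covering_number_def using \<U>(1) r(1,2)
    by (intro Least_le exI[of _ \<B>]) (auto simp: \<B>_def)
  also have "\<dots> \<le> card \<U>" unfolding \<B>_def by (rule card_image_le[OF \<U>(1)])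
  finally show ?thesis using \<U>(2) by linarith
qed

text \<open>At scale \<open>\<epsilon>\<close> the cover of index \<open>k\<close> is fine enough once \<open>k\<close> exceeds
  \<open>x = (ln d - ln \<epsilon>) / (- ln \<zeta>)\<close>. Taking the least such \<open>k\<close>, at most \<open>x + 1\<close>, bounds the
  quotient defining the dimension by \<open>b \<epsilon>\<close>, which tends to \<open>ln Q / (- ln \<zeta>)\<close>.\<close>

lemma fractal_dim_le_of_geometric_covers:
  assumes cov: "\<And>k. small_cover K (\<zeta> ^ k * d) (Q ^ k)"
    and \<zeta>: "0 < \<zeta>" "\<zeta> < 1" and d: "d > 0" and Q: "Q \<ge> 1"
  shows "fractal_dim K \<le> ereal (ln Q / (- ln \<zeta>))"
proof -
  define c where "c = - ln \<zeta>"
  have c: "c > 0" using \<zeta> by (simp add: c_def)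
  define b where "b \<epsilon> = ln Q / c * (1 - (ln d + c) / ln \<epsilon>)" for \<epsilon>
  have "eventually (\<lambda>\<epsilon>. \<epsilon> \<in> {0<..<min 1 d}) (at_right 0)"
    by (rule eventually_at_right_real) (use d in simp)
  then have "eventually (\<lambda>\<epsilon>. ereal (ln (real (covering_number \<epsilon> K)) / (- ln \<epsilon>)) \<le> ereal (b \<epsilon>))
    (at_right 0)"
  proof eventually_elim
    case (elim \<epsilon>)
    then have \<epsilon>: "0 < \<epsilon>" "\<epsilon> < 1" "\<epsilon> < d" by auto
    have ln: "ln \<epsilon> < 0" "ln \<epsilon> < ln d" using \<epsilon> d by auto
    define x where "x = (ln d - ln \<epsilon>) / c"
    define k where "k = nat (\<lfloor>x\<rfloor> + 1)"
    have "x \<ge> 0" using ln c by (simp add: x_def)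
    then have k: "x < real k" "real k \<le> x + 1" unfolding k_def by linarith+
    have "\<zeta> ^ k * d < \<epsilon>"
    proof -
      have "ln (\<zeta> ^ k * d) = ln d - real k * c"
        using \<zeta> d by (simp add: ln_mult ln_realpow c_def)
      also have "\<dots> < ln \<epsilon>" using k(1) c by (simp add: x_def field_simps)
      finally show ?thesis using \<zeta> d \<epsilon> by simp
    qed
    then have N: "real (covering_number \<epsilon> K) \<le> Q ^ k"
      using cov[of k] \<zeta> d by (intro covering_number_le) auto
    have "ln (real (covering_number \<epsilon> K)) \<le> real k * ln Q"
    proof (cases "covering_number \<epsilon> K = 0")
      case True
      then show ?thesis using Q by simp
    next
      case False
      then have "ln (real (covering_number \<epsilon> K)) \<le> ln (Q ^ k)" using N Q by simp
      then show ?thesis using Q by (simp add: ln_realpow)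
    qed
    also have "\<dots> \<le> (x + 1) * ln Q" using k(2) Q by (intro mult_right_mono) auto
    finally have "ln (real (covering_number \<epsilon> K)) / (- ln \<epsilon>) \<le> (x + 1) * ln Q / (- ln \<epsilon>)"
      using ln by (intro divide_right_mono) auto
    also have "\<dots> = b \<epsilon>" using ln c by (simp add: b_def x_def field_simps)
    finally show ?case by simp
  qed
  then have "fractal_dim K \<le> Limsup (at_right 0) (\<lambda>\<epsilon>. ereal (b \<epsilon>))"
    unfolding fractal_dim_def by (rule Limsup_mono)
  also have "\<dots> = ereal (ln Q / c)"
  proof (rule lim_imp_Limsup)
    have "((\<lambda>\<epsilon>. (ln d + c) / ln \<epsilon>) \<longlongrightarrow> 0) (at_right 0)"
      by (intro tendsto_divide_0[OF tendsto_const] filterlim_at_bot_imp_at_infinity ln_at_0)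
    then have "(b \<longlongrightarrow> ln Q / c * (1 - 0)) (at_right 0)"
      unfolding b_def by (intro tendsto_intros)
    then show "((\<lambda>\<epsilon>. ereal (b \<epsilon>)) \<longlongrightarrow> ereal (ln Q / c)) (at_right 0)" by simp
  qed simp
  finally show ?thesis by (simp add: c_def)
qed

section \<open>The dimension of pullback attractors\<close>

lemma small_cover_of_bounded:
  assumes "\<And>x. x \<in> K \<Longrightarrow> norm x \<le> R"
  shows "small_cover K (2 * R) 1"
  unfolding small_cover_def
proof (intro exI[of _ "{K}"] conjI ballI)
  fix U x y assume "U \<in> {K}" "x \<in> U" "y \<in> U"
  then show "norm (x - y) \<le> 2 * R"
    using norm_triangle_ineq4[of x y] assms[of x] assms[of y] by auto
qed auto

lemma projection_of_rank_basis:
  assumes "projection_of_rank P n"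
  obtains B where "finite B" "independent B" "range P \<subseteq> span B" "card B = n"
proof -
  obtain B where B: "B \<subseteq> range P" "independent B" "range P \<subseteq> span B" "card B = dim (range P)"
    by (rule basis_exists)
  obtain E where E: "finite E" "range P = span E"
    using assms unfolding projection_of_rank_def by blast
  have "finite B" using independent_span_bound[OF E(1) B(2)] B(1) E(2) by simp
  then show ?thesis using that B assms by (simp add: projection_of_rank_def)
qed

theorem theorem3p2:
  fixes S :: "real \<Rightarrow> real \<Rightarrow> 'a::banach \<Rightarrow> 'a"
    and A :: "real \<Rightarrow> 'a set"
    and P :: "real \<Rightarrow> 'a \<Rightarrow> 'a"
    and \<Lambda> :: nat
    and M1 M2 M3 lam0 lam1 s0 \<alpha> \<zeta> :: real
  assumes "evolution_process S"
    and "pullback_attractor S A"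
    and "(SUP t. SUP u\<in>A t. ennreal (norm u)) < \<infinity>"
    and "\<Lambda> \<ge> 1"
    and "\<And>t. projection_of_rank (P t) \<Lambda>"
    and "M1 > 0" and "M2 > 0" and "M3 > 0" and "s0 \<ge> 0"
    and "\<And>t \<phi> \<psi>. \<phi> \<in> A (t - s0) \<Longrightarrow> \<psi> \<in> A (t - s0) \<Longrightarrow>
      norm (P t (S t (t - s0) \<phi>) - P t (S t (t - s0) \<psi>))
        \<le> M1 * exp (lam0 * s0) * norm (\<phi> - \<psi>)"
    and "\<And>t \<phi> \<psi>. \<phi> \<in> A (t - s0) \<Longrightarrow> \<psi> \<in> A (t - s0) \<Longrightarrow>
      norm ((S t (t - s0) \<phi> - P t (S t (t - s0) \<phi>)) - (S t (t - s0) \<psi> - P t (S t (t - s0) \<psi>)))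
        \<le> (M2 * exp (lam1 * s0) + M3 * exp (lam0 * s0)) * norm (\<phi> - \<psi>)"
    and "0 < \<alpha>" and "\<alpha> < M1"
    and "\<zeta> = \<alpha> * exp (lam0 * s0) + M2 * exp (lam1 * s0) + M3 * exp (lam0 * s0)"
    and "\<zeta> < 1"
  shows "\<forall>t. fractal_dim (A t)
            \<le> ereal ((ln (real \<Lambda>) + real \<Lambda> * ln (2 + 2 * M1 / \<alpha>)) / (- ln \<zeta>))
          \<and> ereal ((ln (real \<Lambda>) + real \<Lambda> * ln (2 + 2 * M1 / \<alpha>)) / (- ln \<zeta>)) < \<infinity>"
proof (intro allI conjI)
  fix t
  let ?Q = "(2 + 2 * M1 / \<alpha>) ^ \<Lambda>"
  define L where "L = M1 * exp (lam0 * s0)"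
  define a where "a = \<alpha> * exp (lam0 * s0)"
  define q where "q = M2 * exp (lam1 * s0) + M3 * exp (lam0 * s0)"
  have pos: "L > 0" "a > 0" "q > 0"
    using assms(6-8) \<open>0 < \<alpha>\<close> by (auto simp: L_def a_def q_def intro!: add_pos_pos)
  have \<zeta>: "\<zeta> = a + q" "0 < \<zeta>" "\<zeta> < 1"
    using assms(14,15) pos by (auto simp: a_def q_def)
  have ratio: "2 * L / a = 2 * M1 / \<alpha>" by (simp add: L_def a_def)
  have base: "2 + 2 * M1 / \<alpha> \<ge> 1" using \<open>M1 > 0\<close> \<open>0 < \<alpha>\<close> by (simp add: add_increasing2)
  obtain R0 where R0: "R0 \<ge> 0" "(SUP t. SUP u\<in>A t. ennreal (norm u)) = ennreal R0"
    using assms(3) by (cases "SUP t. SUP u\<in>A t. ennreal (norm u)" rule: ennreal_cases) auto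
  define R where "R = R0 + 1"
  have "R > 0" using R0 by (simp add: R_def)
  have R: "norm u \<le> R" if "u \<in> A t" for t u
  proof -
    have "ennreal (norm u) \<le> (SUP t. SUP u\<in>A t. ennreal (norm u))"
      using that by (meson SUP_upper UNIV_I order_trans)
    then have "norm u \<le> R0" using R0 by simp
    then show "norm u \<le> R" by (simp add: R_def)
  qed
  have invariant: "S t (t - s0) ` A (t - s0) = A t" for t
    using assms(2) \<open>s0 \<ge> 0\<close> unfolding pullback_attractor_def by simp
  \<comment> \<open>The bound \<open>R\<close> is uniform in time, so the iteration may start at the time \<open>t - k * s0\<close>, with
    the whole set as a single covering set.\<close>
  have covers: "small_cover (A t) (\<zeta> ^ k * (2 * R)) (?Q ^ k)" for k t
  proof (induction k arbitrary: t)
    case 0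
    then show ?case using small_cover_of_bounded[of "A t" R] R by simp
  next
    case (Suc k)
    obtain B where B: "finite B" "independent B" "range (P t) \<subseteq> span B" "card B = \<Lambda>"
      using projection_of_rank_basis[OF assms(5)] by metis
    have "small_cover (S t (t - s0) ` A (t - s0)) ((a + q) * (\<zeta> ^ k * (2 * R)))
        (?Q ^ k * (2 + 2 * L / a) ^ card B)"
    proof (rule small_cover_image[OF Suc _ B(1,2)])
      show "range (P t) \<subseteq> span B" by (rule B)
    qed (use pos \<zeta> \<open>R > 0\<close> assms(10,11) in \<open>simp_all add: L_def q_def\<close>)
    then show ?case
      unfolding invariant ratio B(4) \<zeta>(1) by (simp only: power_Suc mult_ac)
  qed
  have "fractal_dim (A t) \<le> ereal (ln ?Q / (- ln \<zeta>))"
    by (rule fractal_dim_le_of_geometric_covers[OF covers])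
       (use \<zeta> \<open>R > 0\<close> base in \<open>auto intro: one_le_power\<close>)
  also have "ln ?Q = real \<Lambda> * ln (2 + 2 * M1 / \<alpha>)" using base by (simp add: ln_realpow)
  \<comment> \<open>The summand \<open>ln \<Lambda>\<close> is nonnegative because \<open>\<Lambda> \<ge> 1\<close>.\<close>
  also have "\<dots> / (- ln \<zeta>) \<le> (ln (real \<Lambda>) + real \<Lambda> * ln (2 + 2 * M1 / \<alpha>)) / (- ln \<zeta>)"
    using \<open>\<Lambda> \<ge> 1\<close> \<zeta> by (intro divide_right_mono) auto
  finally show "fractal_dim (A t)
      \<le> ereal ((ln (real \<Lambda>) + real \<Lambda> * ln (2 + 2 * M1 / \<alpha>)) / (- ln \<zeta>))"
    by simp
qed simp

end
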